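(* For every integer $M\ge 1$, the absorbing probabilities of the Grover walk with a single absorbing boundary at $-M$ satisfy $$P_{\underline{-M,0,\infty}}(1,0,0)=\frac1{2\pi}\int_0^{2\pi}|L(\theta)|^{2M}\,d\theta,$$ $$P_{\underline{-M,0,\infty}}(0,1,0)=\frac1{2\pi}\int_0^{2\pi}|S(\theta)|^2|L(\theta)|^{2M-2}\,d\theta,$$ $$P_{\underline{-M,0,\infty}}(0,0,1)=\frac1{2\pi}\int_0^{2\pi}|R(\theta)|^2|L(\theta)|^{2M-2}\,d\theta,$$ where $L(\theta)=l(e^{i\theta})$, $S(\theta)=s(e^{i\theta})$, $R(\theta)=r(e^{i\theta})$ and $l,s,r$ are the generating functions for the boundary at $-1$.
   Context: The Grover walk acts on the Hilbert space $\mathcal H=\ell^2(\mathbb Z)\otimes\mathbb C^3$ with orthonormal basis $|m,c\rangle=|m\rangle\otimes|c\rangle$, $m\in\mathbb Z$, $c\in\{L,S,R\}$. The evolution operator is $U=\mathrm{Sh}\cdot(I\otimes G)$, where, in the ordered basis $(L,S,R)$, $G=\frac13\begin{pmatrix}-1&2&2\\2&-1&2\\2&2&-1\end{pmatrix}$, and the shift is $\mathrm{Sh}|m,L\rangle=|m-1,L\rangle$, $\mathrm{Sh}|m,S\rangle=|m,S\rangle$, $\mathrm{Sh}|m,R\rangle=|m+1,R\rangle$. For $n\in\mathbb Z$, $\Pi_{yes}^{n}=|n\rangle\langle n|\otimes I$ and $\Pi_{no}^{n}=I-\Pi_{yes}^{n}$. One-boundary process: start in $\psi_0=\alpha|0,L\rangle+\beta|0,S\rangle+\gamma|0,R\rangle$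 with $|\alpha|^2+|\beta|^2+|\gamma|^2=1$; at each step apply $U$, then measure $\{\Pi_{yes}^{-M},\Pi_{no}^{-M}\}$, stopping when the outcome is "yes". The absorbing probability is the probability that "yes" eventually occurs: $$P_{\underline{-M,0,\infty}}(\alpha,\beta,\gamma)=\sum_{t\ge1}\big\|\Pi_{yes}^{-M}U(\Pi_{no}^{-M}U)^{t-1}\psi_0\big\|^2 .$$ The generating functions are, for $c=L,S,R$ respectively, $l(z),s(z),r(z)=\sum_{t\ge1}\langle-1,L|U(\Pi_{no}^{-1}U)^{t-1}|0,c\rangle z^t$; values at $z=e^{i\theta}$ are boundary values on the unit circle. *)

theory Defs
  imports "HOL-Analysis.Analysis"
begin

datatype coin = L | S | R

lemma UNIV_coin: "(UNIV :: coin set) = {L, S, R}"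
  using coin.exhaust by auto

instance coin :: finite
  by standard (simp add: UNIV_coin)

text \<open>
  A vector of \<open>\<ell>\<^sup>2(\<int>) \<otimes> \<complex>\<^sup>3\<close> is represented by its coefficient function in the basis
  \<open>|m,c\<rangle>\<close>; the Hilbert space itself is the set \<open>ell2\<close>, which the operators below preserve.
\<close>

type_synonym walk_state = "int \<times> coin \<Rightarrow> complex"

definition ell2 :: "walk_state set" where
  "ell2 = {\<psi>. (\<lambda>x. (cmod (\<psi> x))\<^sup>2) summable_on UNIV}"

definition ell2_norm :: "walk_state \<Rightarrow> real" where
  "ell2_norm \<psi> = sqrt (\<Sum>\<^sub>\<infinity>x. (cmod (\<psi> x))\<^sup>2)"

definition ell2_inner :: "walk_state \<Rightarrow> walk_state \<Rightarrow> complex" where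
  "ell2_inner \<phi> \<psi> = (\<Sum>\<^sub>\<infinity>x. cnj (\<phi> x) * \<psi> x)"

definition ket :: "int \<Rightarrow> coin \<Rightarrow> walk_state" where
  "ket m c = (\<lambda>x. if x = (m, c) then 1 else 0)"

definition grover :: "coin \<Rightarrow> coin \<Rightarrow> complex" where
  "grover c d = (if c = d then - 1 / 3 else 2 / 3)"

definition coin_op :: "walk_state \<Rightarrow> walk_state" where
  "coin_op \<psi> = (\<lambda>(m, c). \<Sum>d\<in>UNIV. grover c d * \<psi> (m, d))"

fun shift_pos :: "int \<times> coin \<Rightarrow> int \<times> coin" where
  "shift_pos (m, L) = (m - 1, L)"
| "shift_pos (m, S) = (m, S)"
| "shift_pos (m, R) = (m + 1, R)"

definition shift :: "walk_state \<Rightarrow> walk_state" where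
  "shift \<psi> = (\<lambda>x. \<psi> (inv shift_pos x))"

definition evolution :: "walk_state \<Rightarrow> walk_state" where
  "evolution \<psi> = shift (coin_op \<psi>)"

definition proj_yes :: "int \<Rightarrow> walk_state \<Rightarrow> walk_state" where
  "proj_yes n \<psi> = (\<lambda>(m, c). if m = n then \<psi> (m, c) else 0)"

definition proj_no :: "int \<Rightarrow> walk_state \<Rightarrow> walk_state" where
  "proj_no n \<psi> = (\<lambda>x. \<psi> x - proj_yes n \<psi> x)"

definition init_state :: "complex \<Rightarrow> complex \<Rightarrow> complex \<Rightarrow> walk_state" where
  "init_state \<alpha> \<beta> \<gamma> = (\<lambda>x. \<alpha> * ket 0 L x + \<beta> * ket 0 S x + \<gamma> * ket 0 R x)"

text \<open>In the two series below the index \<open>t\<close> starts at 0 and stands for (number of steps) - 1.\<close>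

definition absorb_prob :: "nat \<Rightarrow> complex \<Rightarrow> complex \<Rightarrow> complex \<Rightarrow> real" where
  "absorb_prob M \<alpha> \<beta> \<gamma> =
     (\<Sum>t. (ell2_norm (proj_yes (- int M)
        (evolution (((\<lambda>\<psi>. proj_no (- int M) (evolution \<psi>)) ^^ t) (init_state \<alpha> \<beta> \<gamma>)))))\<^sup>2)"

definition gen_fun :: "coin \<Rightarrow> complex \<Rightarrow> complex" where
  "gen_fun c z =
     (\<Sum>t. ell2_inner (ket (-1) L)
        (evolution (((\<lambda>\<psi>. proj_no (-1) (evolution \<psi>)) ^^ t) (ket 0 c))) * z ^ Suc t)"

text \<open>Boundary values on the unit circle are radial limits from inside the disc.\<close>

definition boundary_value :: "(complex \<Rightarrow> complex) \<Rightarrow> real \<Rightarrow> complex" where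
  "boundary_value f \<theta> = Lim (at_left 1) (\<lambda>\<rho>. f (complex_of_real \<rho> * cis \<theta>))"

definition L_bdry :: "real \<Rightarrow> complex" where
  "L_bdry \<theta> = boundary_value (gen_fun L) \<theta>"

definition S_bdry :: "real \<Rightarrow> complex" where
  "S_bdry \<theta> = boundary_value (gen_fun S) \<theta>"

definition R_bdry :: "real \<Rightarrow> complex" where
  "R_bdry \<theta> = boundary_value (gen_fun R) \<theta>"

lemma bij_shift_pos: "bij shift_pos"
proof (rule o_bij)
  let ?g = "\<lambda>(m, c). (case c of L \<Rightarrow> (m + 1, L) | S \<Rightarrow> (m, S) | R \<Rightarrow> (m - 1, R))"
  show "?g \<circ> shift_pos = id"
  proof
    fix x show "(?g \<circ> shift_pos) x = id x" by (cases x rule: shift_pos.cases) auto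
  qed
  show "shift_pos \<circ> ?g = id"
    by (auto simp: fun_eq_iff split: coin.splits)
qed

lemma shift_ket: "shift (ket m c) = ket (fst (shift_pos (m, c))) c"
proof -
  have "shift (ket m c) x = ket (fst (shift_pos (m, c))) c x" for x
  proof -
    have "inv shift_pos x = (m, c) \<longleftrightarrow> x = shift_pos (m, c)"
      using bij_shift_pos by (metis bij_inv_eq_iff)
    moreover have "snd (shift_pos (m, c)) = c" by (cases c) auto
    ultimately show ?thesis by (simp add: shift_def ket_def prod_eq_iff)
  qed
  then show ?thesis by blast
qed

lemma coin_op_norm:
  "(\<Sum>c\<in>UNIV. (cmod (coin_op \<psi> (m, c)))\<^sup>2) = (\<Sum>c\<in>UNIV. (cmod (\<psi> (m, c)))\<^sup>2)"
proof -
  have "(cmod (- (x / 3) + (2 * y / 3 + 2 * z / 3)))\<^sup>2 + ((cmod (2 * x / 3 + (2 * z / 3 - y / 3)))\<^sup>2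
      + (cmod (2 * x / 3 + (2 * y / 3 - z / 3)))\<^sup>2) = (cmod x)\<^sup>2 + ((cmod y)\<^sup>2 + (cmod z)\<^sup>2)"
    for x y z :: complex
    unfolding cmod_power2 by (simp add: power2_eq_square) algebra
  from this[of "\<psi> (m, L)" "\<psi> (m, S)" "\<psi> (m, R)"] show ?thesis
    by (simp add: coin_op_def grover_def UNIV_coin algebra_simps)
qed

lemma evolution_ell2:
  assumes "\<psi> \<in> ell2"
  shows "evolution \<psi> \<in> ell2" and "ell2_norm (evolution \<psi>) = ell2_norm \<psi>"
proof -
  define q where "q \<phi> x = (cmod (\<phi> x))\<^sup>2" for \<phi> :: walk_state and x
  have q_nonneg: "q \<phi> x \<ge> 0" for \<phi> x
    by (simp add: q_def)
  have sum_iff: "q \<phi> summable_on UNIV \<longleftrightarrow> (\<lambda>m. \<Sum>c\<in>UNIV. q \<phi> (m, c)) summable_on UNIV"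
    for \<phi>
    using Infinite_Sum.abs_summable_on_Sigma_iff[of "q \<phi>" UNIV "\<lambda>_. UNIV"]
    by (simp add: q_nonneg sum_nonneg)
  have inf_eq: "infsum (q \<phi>) UNIV = (\<Sum>\<^sub>\<infinity>m. \<Sum>c\<in>UNIV. q \<phi> (m, c))"
    if "q \<phi> summable_on UNIV" for \<phi>
    using infsum_Sigma_banach[where f = "q \<phi>" and A = UNIV and B = "\<lambda>_. UNIV"] that by simp
  have coin: "(\<Sum>c\<in>UNIV. q (coin_op \<psi>) (m, c)) = (\<Sum>c\<in>UNIV. q \<psi> (m, c))" for m
    unfolding q_def by (rule coin_op_norm)
  have s: "q \<psi> summable_on UNIV"
    using assms by (simp add: ell2_def q_def[abs_def])
  then have sc: "q (coin_op \<psi>) summable_on UNIV"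
    by (simp add: sum_iff coin)
  have ic: "infsum (q (coin_op \<psi>)) UNIV = infsum (q \<psi>) UNIV"
    using s sc by (simp add: inf_eq coin)
  have b: "bij (inv shift_pos)"
    by (rule bij_imp_bij_inv[OF bij_shift_pos])
  have q_ev: "q (evolution \<psi>) = (\<lambda>x. q (coin_op \<psi>) (inv shift_pos x))"
    by (simp add: q_def evolution_def shift_def fun_eq_iff)
  have "q (evolution \<psi>) summable_on UNIV"
    unfolding q_ev using summable_on_reindex_bij_betw[OF b, of "q (coin_op \<psi>)"] sc by blast
  then show "evolution \<psi> \<in> ell2"
    by (simp add: ell2_def q_def[abs_def])
  have "infsum (q (evolution \<psi>)) UNIV = infsum (q \<psi>) UNIV"
    unfolding q_ev using infsum_reindex_bij_betw[OF b, of "q (coin_op \<psi>)"] ic by simp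
  then show "ell2_norm (evolution \<psi>) = ell2_norm \<psi>"
    by (simp add: ell2_norm_def q_def[abs_def])
qed

lemma proj_ell2:
  assumes "\<psi> \<in> ell2"
  shows "proj_yes n \<psi> \<in> ell2" and "proj_no n \<psi> \<in> ell2"
proof -
  have "(\<lambda>x. (cmod (\<psi> x))\<^sup>2) summable_on UNIV"
    using assms by (simp add: ell2_def)
  then show "proj_yes n \<psi> \<in> ell2" "proj_no n \<psi> \<in> ell2"
    unfolding ell2_def mem_Collect_eq
    by (rule summable_on_comparison_test; auto simp: proj_yes_def proj_no_def)+
qed

end

(*
A walk started at 0 can only hit -M after hitting -1 in the state |-1,L>, from where it faces a
boundary M - 1 sites away. Hence the generating function of the hitting amplitudes at -M is
g_c(z) l(z)^(M-1), where g_c is l, s or r, and the absorbing probability, being the sum of the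
squared moduli of its coefficients, is given by Parseval's identity once the boundary values are
under control.

For this, one step of the walk expresses l, s and r through p = r l as rational functions with
denominator 3 + z, and p solves 2 z^2 p^2 + (5 z^2 + 6 z + 9) p + 2 z^2 = 0. No root of this quadratic
has modulus 1 when |z| < 1, so by connectedness |p| < 1 in the disc and l, s, r are bounded. Along
a radius p is a continuous root of a quadratic with convergent coefficients, so it has a limit at
every boundary point, and dominated convergence carries Parseval's identity to the unit circle.
*)

theory Submission
  imports Defs
begin

section \<open>Parseval's identity for bounded power series\<close>

lemma cis_has_integral:
  fixes k :: int
  shows "((\<lambda>\<theta>. cis (of_int k * \<theta>)) has_integral (if k = 0 then of_real (2 * pi) else 0)) {0..2 * pi}"
proof (cases "k = 0")
  case True
  then show ?thesis
    using has_integral_const_real[of "1::complex" 0 "2 * pi"] by (simp add: scaleR_conv_of_real)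
next
  case False
  have "((\<lambda>\<theta>. cis (of_int k * \<theta>)) has_integral
      (cis (of_int k * (2 * pi)) / (\<i> * of_int k) - cis (of_int k * 0) / (\<i> * of_int k))) {0..2 * pi}"
  proof (rule fundamental_theorem_of_calculus)
    fix x :: real
    \<comment> \<open>The antiderivative is differentiated as a complex function and then restricted
      to the real line.\<close>
    have "((\<lambda>z. exp (\<i> * of_int k * z) / (\<i> * of_int k)) has_field_derivative
        exp (\<i> * of_int k * of_real x)) (at (of_real x))"
      using False by (auto intro!: derivative_eq_intros)
    from has_vector_derivative_real_field[OF this]
    show "((\<lambda>\<theta>. cis (of_int k * \<theta>) / (\<i> * of_int k)) has_vector_derivative cis (of_int k * x))
        (at x within {0..2 * pi})"
      by (simp add: cis_conv_exp mult_ac)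
  qed simp
  moreover have "cis (of_int k * (2 * pi)) = 1"
    using cis_multiple_2pi[of "of_int k"] by (simp add: mult_ac)
  ultimately show ?thesis
    using False by simp
qed

text \<open>Expanding the squared modulus as a double sum leaves only the diagonal terms, by
  orthogonality of the characters \<open>cis (k * \<theta>)\<close>.\<close>

lemma trigonometric_polynomial_parseval:
  fixes b :: "nat \<Rightarrow> complex"
  shows "((\<lambda>\<theta>. (cmod (\<Sum>t<N. b t * cis \<theta> ^ t))\<^sup>2) has_integral (2 * pi * (\<Sum>t<N. (cmod (b t))\<^sup>2)))
    {0..2 * pi}"
proof -
  have "((\<lambda>\<theta>. \<Sum>s<N. \<Sum>t<N. b s * cnj (b t) * cis (of_int (int s - int t) * \<theta>)) has_integral
     (\<Sum>s<N. \<Sum>t<N. b s * cnj (b t) * (if int s - int t = 0 then of_real (2 * pi) else 0))) {0..2 * pi}"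
    by (intro has_integral_sum finite_lessThan has_integral_mult_right cis_has_integral)
  also have "(\<lambda>\<theta>. \<Sum>s<N. \<Sum>t<N. b s * cnj (b t) * cis (of_int (int s - int t) * \<theta>)) =
      (\<lambda>\<theta>. of_real ((cmod (\<Sum>t<N. b t * cis \<theta> ^ t))\<^sup>2))"
  proof
    fix \<theta> :: real
    have cis_diff: "cis (of_int (int s - int t) * \<theta>) = cis \<theta> ^ s * cnj (cis \<theta> ^ t)" for s t
      by (simp add: Complex.DeMoivre cis_mult cis_cnj algebra_simps)
    show "(\<Sum>s<N. \<Sum>t<N. b s * cnj (b t) * cis (of_int (int s - int t) * \<theta>)) =
        of_real ((cmod (\<Sum>t<N. b t * cis \<theta> ^ t))\<^sup>2)"
      unfolding cis_diff complex_norm_square cnj_sum sum_product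
      by (intro sum.cong refl) simp
  qed
  also have "(\<Sum>s<N. \<Sum>t<N. b s * cnj (b t) * (if int s - int t = 0 then of_real (2 * pi) else 0)) =
      of_real (2 * pi * (\<Sum>t<N. (cmod (b t))\<^sup>2))"
  proof -
    have "(\<Sum>t<N. b s * cnj (b t) * (if int s - int t = 0 then of_real (2 * pi) else 0)) =
        of_real (2 * pi * (cmod (b s))\<^sup>2)" if "s < N" for s
    proof -
      have "(\<Sum>t<N. b s * cnj (b t) * (if int s - int t = 0 then of_real (2 * pi) else 0)) =
          (\<Sum>t<N. if t = s then b s * cnj (b s) * of_real (2 * pi) else 0)"
        by (intro sum.cong refl) auto
      also have "\<dots> = of_real (2 * pi) * (b s * cnj (b s))"
        using that by simp
      finally show ?thesis
        by (simp only: of_real_mult complex_norm_square)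
    qed
    then have "(\<Sum>s<N. \<Sum>t<N. b s * cnj (b t) * (if int s - int t = 0 then of_real (2 * pi) else 0)) =
        (\<Sum>s<N. of_real (2 * pi * (cmod (b s))\<^sup>2))"
      by (intro sum.cong refl) auto
    then show ?thesis
      by (simp only: sum_distrib_left of_real_sum)
  qed
  finally have "((\<lambda>\<theta>. of_real ((cmod (\<Sum>t<N. b t * cis \<theta> ^ t))\<^sup>2) :: complex) has_integral
      of_real (2 * pi * (\<Sum>t<N. (cmod (b t))\<^sup>2))) {0..2 * pi}" .
  \<comment> \<open>The double sum was integrated over the complex numbers; its value is real, so
    taking real parts loses nothing.\<close>
  from has_integral_linear[OF this bounded_linear_Re] show ?thesis
    by (simp only: o_def Re_complex_of_real)
qed

text \<open>Absolute summability bounds all partial sums uniformly on the circle, so dominated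
  convergence carries over the finite identity.\<close>

lemma power_series_parseval:
  fixes b :: "nat \<Rightarrow> complex"
  assumes b: "summable (\<lambda>t. cmod (b t))"
  shows "(\<lambda>\<theta>. (cmod (\<Sum>t. b t * cis \<theta> ^ t))\<^sup>2) integrable_on {0..2 * pi}"
    and "(\<lambda>t. (cmod (b t))\<^sup>2) sums
      (1 / (2 * pi) * integral {0..2 * pi} (\<lambda>\<theta>. (cmod (\<Sum>t. b t * cis \<theta> ^ t))\<^sup>2))"
proof -
  let ?P = "\<lambda>N \<theta>. \<Sum>t<N. b t * cis \<theta> ^ t" and ?F = "\<lambda>\<theta>. \<Sum>t. b t * cis \<theta> ^ t"
  have bound: "cmod (?P N \<theta>) \<le> (\<Sum>t. cmod (b t))" for N \<theta>
  proof -
    have "cmod (?P N \<theta>) \<le> (\<Sum>t<N. cmod (b t))"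
      by (rule order_trans[OF norm_sum]) (simp add: norm_mult norm_power)
    also have "\<dots> \<le> (\<Sum>t. cmod (b t))"
      by (rule sum_le_suminf[OF b]) auto
    finally show ?thesis .
  qed
  have int: "(\<lambda>\<theta>. (cmod (?P N \<theta>))\<^sup>2) integrable_on {0..2 * pi}" for N
    using trigonometric_polynomial_parseval by (rule has_integral_integrable)
  have le: "norm ((cmod (?P N \<theta>))\<^sup>2) \<le> (\<Sum>t. cmod (b t))\<^sup>2" for N \<theta>
    using bound by (simp add: power_mono)
  have lim: "(\<lambda>N. (cmod (?P N \<theta>))\<^sup>2) \<longlonglongrightarrow> (cmod (?F \<theta>))\<^sup>2" for \<theta>
  proof -
    have "summable (\<lambda>t. b t * cis \<theta> ^ t)"
      by (rule summable_comparison_test'[OF b]) (simp add: norm_mult norm_power)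
    then show ?thesis
      by (intro tendsto_intros summable_LIMSEQ)
  qed
  have h: "(\<lambda>_. (\<Sum>t. cmod (b t))\<^sup>2) integrable_on {0..2 * pi}"
    by auto
  show "(\<lambda>\<theta>. (cmod (?F \<theta>))\<^sup>2) integrable_on {0..2 * pi}"
    by (rule dominated_convergence(1)[OF int h le lim])
  have dc: "(\<lambda>N. integral {0..2 * pi} (\<lambda>\<theta>. (cmod (?P N \<theta>))\<^sup>2)) \<longlonglongrightarrow>
      integral {0..2 * pi} (\<lambda>\<theta>. (cmod (?F \<theta>))\<^sup>2)"
    by (rule dominated_convergence(2)[OF int h le lim])
  have "(\<lambda>N. 1 / (2 * pi) * integral {0..2 * pi} (\<lambda>\<theta>. (cmod (?P N \<theta>))\<^sup>2)) \<longlonglongrightarrow>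
      1 / (2 * pi) * integral {0..2 * pi} (\<lambda>\<theta>. (cmod (?F \<theta>))\<^sup>2)"
    by (intro tendsto_intros dc)
  then show "(\<lambda>t. (cmod (b t))\<^sup>2) sums (1 / (2 * pi) * integral {0..2 * pi} (\<lambda>\<theta>. (cmod (?F \<theta>))\<^sup>2))"
    by (simp add: sums_def integral_unique[OF trigonometric_polynomial_parseval])
qed

text \<open>The series need not converge absolutely on the unit circle, so Parseval is applied on
  circles of radius \<open>\<rho> k < 1\<close>. As \<open>\<rho> k\<close> tends to 1, the
  integrals converge by dominated convergence with bound \<open>C\<^sup>2\<close>, and the
  coefficient sums by Tannery's theorem.\<close>

lemma bounded_power_series_parseval:
  fixes a :: "nat \<Rightarrow> complex" and F :: "complex \<Rightarrow> complex"
  assumes F: "\<And>z. cmod z < 1 \<Longrightarrow> (\<lambda>t. a t * z ^ t) sums F z"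
    and bound: "\<And>z. cmod z < 1 \<Longrightarrow> cmod (F z) \<le> C"
    and lim: "\<And>\<theta>. ((\<lambda>\<rho>. F (of_real \<rho> * cis \<theta>)) \<longlongrightarrow> G \<theta>) (at_left 1)"
  shows "(\<lambda>t. (cmod (a t))\<^sup>2) sums (1 / (2 * pi) * integral {0..2 * pi} (\<lambda>\<theta>. (cmod (G \<theta>))\<^sup>2))"
proof -
  define \<rho> :: "nat \<Rightarrow> real" where "\<rho> k = 1 - inverse (real (Suc k))" for k
  have \<rho>: "0 \<le> \<rho> k" "\<rho> k < 1" for k
    by (auto simp: \<rho>_def field_simps)
  have \<rho>_lim: "\<rho> \<longlonglongrightarrow> 1"
    unfolding \<rho>_def using tendsto_diff[OF tendsto_const LIMSEQ_inverse_real_of_nat] by simp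
  then have \<rho>_left: "filterlim \<rho> (at_left 1) sequentially"
    using \<rho> by (intro tendsto_imp_filterlim_at_left) auto
  have circle: "cmod (of_real (\<rho> k) * cis \<theta>) < 1" for k \<theta>
    using \<rho>[of k] by (simp add: norm_mult)
  have F_eq: "F (of_real (\<rho> k) * cis \<theta>) = (\<Sum>t. a t * of_real (\<rho> k) ^ t * cis \<theta> ^ t)" for k \<theta>
    using sums_unique[OF F[OF circle]] by (simp add: power_mult_distrib mult_ac)
  \<comment> \<open>The midpoint of \<open>\<rho> k\<close> and 1 is a larger radius at which the
    series still converges.\<close>
  have abs_summable: "summable (\<lambda>t. cmod (a t * of_real (\<rho> k) ^ t))" for k
  proof (rule powser_insidea)
    show "summable (\<lambda>t. a t * (of_real ((\<rho> k + 1) / 2)) ^ t)"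
      using F[of "of_real ((\<rho> k + 1) / 2)"] \<rho>[of k] by (intro sums_summable) (auto simp del: of_real_add of_real_divide)
    show "cmod (of_real (\<rho> k)) < cmod (of_real ((\<rho> k + 1) / 2))"
      using \<rho>[of k] by (auto simp del: of_real_add of_real_divide)
  qed
  note P = power_series_parseval[OF abs_summable, folded F_eq]
  have I: "(\<lambda>k. integral {0..2 * pi} (\<lambda>\<theta>. (cmod (F (of_real (\<rho> k) * cis \<theta>)))\<^sup>2)) \<longlonglongrightarrow>
    integral {0..2 * pi} (\<lambda>\<theta>. (cmod (G \<theta>))\<^sup>2)"
  proof (rule dominated_convergence(2)[where h = "\<lambda>_. C\<^sup>2"])
    show "(\<lambda>\<theta>. (cmod (F (of_real (\<rho> k) * cis \<theta>)))\<^sup>2) integrable_on {0..2 * pi}" for k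
      by (rule P(1))
    show "norm ((cmod (F (of_real (\<rho> k) * cis \<theta>)))\<^sup>2) \<le> C\<^sup>2" for k \<theta>
      using bound[OF circle] by (simp add: power_mono)
    show "(\<lambda>k. (cmod (F (of_real (\<rho> k) * cis \<theta>)))\<^sup>2) \<longlonglongrightarrow> (cmod (G \<theta>))\<^sup>2" for \<theta>
      by (intro tendsto_intros filterlim_compose[OF lim \<rho>_left])
  qed auto
  let ?I = "1 / (2 * pi) * integral {0..2 * pi} (\<lambda>\<theta>. (cmod (G \<theta>))\<^sup>2)"
  let ?s = "\<lambda>k t. (cmod (a t * of_real (\<rho> k) ^ t))\<^sup>2"
  have s_lim: "(\<lambda>k. ?s k t) \<longlonglongrightarrow> (cmod (a t))\<^sup>2" for t
  proof -
    have "(\<lambda>k. ?s k t) \<longlonglongrightarrow> (cmod (a t * of_real 1 ^ t))\<^sup>2"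
      by (intro tendsto_intros \<rho>_lim)
    then show ?thesis by simp
  qed
  have sum_lim: "(\<lambda>k. \<Sum>t. ?s k t) \<longlonglongrightarrow> ?I"
    using tendsto_mult[OF tendsto_const[of "1 / (2 * pi)"] I]
    by (simp add: sums_unique[OF P(2), symmetric])
  \<comment> \<open>Tannery's theorem needs a summable majorant. The squared coefficients themselves
    serve, and their summability comes from comparing partial sums with full sums before letting
    \<open>k\<close> grow.\<close>
  have part: "(\<Sum>t<N. (cmod (a t))\<^sup>2) \<le> ?I" for N
  proof (rule LIMSEQ_le)
    show "(\<lambda>k. \<Sum>t<N. ?s k t) \<longlonglongrightarrow> (\<Sum>t<N. (cmod (a t))\<^sup>2)"
      by (intro tendsto_sum s_lim)
    show "\<exists>K. \<forall>k\<ge>K. (\<Sum>t<N. ?s k t) \<le> (\<Sum>t. ?s k t)"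
      by (auto intro!: exI sum_le_suminf sums_summable[OF P(2)])
  qed (rule sum_lim)
  have summ: "summable (\<lambda>t. (cmod (a t))\<^sup>2)"
    by (rule summableI_nonneg_bounded[where x = ?I]) (use part in auto)
  have sum_lim': "(\<lambda>k. \<Sum>t. ?s k t) \<longlonglongrightarrow> (\<Sum>t. (cmod (a t))\<^sup>2)"
  proof (rule tannerys_theorem[THEN conjunct2, THEN conjunct2])
    show "summable (\<lambda>t. (cmod (a t))\<^sup>2)" by (rule summ)
    show "\<forall>\<^sub>F (t, k) in at_top \<times>\<^sub>F sequentially. norm (?s k t) \<le> (cmod (a t))\<^sup>2"
      using \<rho>(1) less_imp_le[OF \<rho>(2)] by (intro always_eventually)
        (auto simp: norm_mult norm_power power_mult_distrib intro!: mult_left_le power_le_one)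
  qed (use s_lim in auto)
  have "(\<Sum>t. (cmod (a t))\<^sup>2) = ?I"
    by (rule LIMSEQ_unique[OF sum_lim' sum_lim])
  with summ show ?thesis by (simp add: sums_iff)
qed

section \<open>First-passage amplitudes\<close>

lemma evolution_simps:
  "evolution \<psi> (m, L) = coin_op \<psi> (m + 1, L)"
  "evolution \<psi> (m, S) = coin_op \<psi> (m, S)"
  "evolution \<psi> (m, R) = coin_op \<psi> (m - 1, R)"
proof -
  have "inv shift_pos (m, L) = (m + 1, L)" "inv shift_pos (m, S) = (m, S)"
    "inv shift_pos (m, R) = (m - 1, R)"
    by (auto intro!: inv_f_eq bij_is_inj[OF bij_shift_pos])
  then show "evolution \<psi> (m, L) = coin_op \<psi> (m + 1, L)"
    "evolution \<psi> (m, S) = coin_op \<psi> (m, S)" "evolution \<psi> (m, R) = coin_op \<psi> (m - 1, R)"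
    by (simp_all add: evolution_def shift_def)
qed

lemma evolution_linear:
  "evolution (\<lambda>x. f x + c * g x) = (\<lambda>x. evolution f x + c * evolution g x)"
  by (auto simp: evolution_def shift_def coin_op_def fun_eq_iff split: prod.split)
    (simp add: algebra_simps sum.distrib sum_distrib_left)

lemma proj_no_eq: "proj_no n \<psi> = (\<lambda>(m, c). if m = n then 0 else \<psi> (m, c))"
  by (auto simp: proj_no_def proj_yes_def fun_eq_iff)

definition walk_step :: "int \<Rightarrow> walk_state \<Rightarrow> walk_state" where
  "walk_step n \<psi> = proj_no n (evolution \<psi>)"

text \<open>Index \<open>t\<close> stands for absorption at step \<open>t + 1\<close>, which
  explains \<open>z ^ Suc t\<close> in the generating function. Recording only the \<open>L\<close>
  coordinate is enough for walks that start to the right of \<open>n\<close>.\<close>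

definition hit_amp :: "int \<Rightarrow> nat \<Rightarrow> walk_state \<Rightarrow> complex" where
  "hit_amp n t \<psi> = evolution ((walk_step n ^^ t) \<psi>) (n, L)"

definition hit_gen :: "int \<Rightarrow> walk_state \<Rightarrow> complex \<Rightarrow> complex" where
  "hit_gen n \<psi> z = (\<Sum>t. hit_amp n t \<psi> * z ^ Suc t)"

definition supported_right :: "int \<Rightarrow> walk_state \<Rightarrow> bool" where
  "supported_right n \<psi> \<longleftrightarrow> (\<forall>m c. m \<le> n \<longrightarrow> \<psi> (m, c) = 0)"

lemma walk_step_linear:
  "walk_step n (\<lambda>x. f x + c * g x) = (\<lambda>x. walk_step n f x + c * walk_step n g x)"
  by (auto simp: walk_step_def evolution_linear proj_no_eq fun_eq_iff)

lemma hit_amp_0: "hit_amp n 0 \<psi> = evolution \<psi> (n, L)"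
  by (simp add: hit_amp_def)

lemma hit_amp_Suc: "hit_amp n (Suc t) \<psi> = hit_amp n t (walk_step n \<psi>)"
  by (simp add: hit_amp_def funpow_swap1)

lemma hit_amp_linear:
  "hit_amp n t (\<lambda>x. f x + c * g x) = hit_amp n t f + c * hit_amp n t g"
  by (induction t arbitrary: f g)
    (auto simp: hit_amp_0 hit_amp_Suc evolution_linear walk_step_linear)

text \<open>Only the coin state \<open>L\<close> moves left, and only by one site, so
  \<open>(n, L)\<close> is the only position at or left of \<open>n\<close> that one step can
  reach.\<close>

lemma evolution_supported:
  assumes "supported_right n \<psi>" "x \<noteq> (n, L)" "fst x \<le> n"
  shows "evolution \<psi> x = 0"
proof -
  obtain m c where x: "x = (m, c)" by (cases x)
  show ?thesis
    using assms unfolding x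
    by (cases c) (auto simp: evolution_simps coin_op_def supported_right_def)
qed

lemma walk_step_supported:
  assumes "supported_right n \<psi>"
  shows "supported_right n (walk_step n \<psi>)"
  unfolding supported_right_def
proof (intro allI impI)
  fix m c assume "m \<le> n"
  then show "walk_step n \<psi> (m, c) = 0"
    using evolution_supported[OF assms, of "(m, c)"] by (auto simp: walk_step_def proj_no_eq)
qed

lemma funpow_walk_step_supported:
  "supported_right n \<psi> \<Longrightarrow> supported_right n ((walk_step n ^^ t) \<psi>)"
  by (induction t) (auto intro: walk_step_supported)

text \<open>After one step nothing has reached \<open>n\<close>, so the boundary there removes
  nothing; the boundary at \<open>m\<close> removes exactly the \<open>(m, L)\<close>
  component.\<close>

lemma walk_step_farther_boundary:
  assumes "supported_right m \<psi>" "n < m"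
  shows "walk_step n \<psi> = (\<lambda>x. walk_step m \<psi> x + hit_amp m 0 \<psi> * ket m L x)"
proof
  fix x :: "int \<times> coin"
  show "walk_step n \<psi> x = walk_step m \<psi> x + hit_amp m 0 \<psi> * ket m L x"
    using evolution_supported[OF assms(1), of x] assms(2)
    by (cases x) (auto simp: walk_step_def proj_no_eq ket_def hit_amp_0)
qed

text \<open>First-passage decomposition: a walk started to the right of \<open>m > n\<close> moves left by at most
  one site at a time, so it hits \<open>m\<close> in state \<open>|m,L\<rangle>\<close> before it can hit \<open>n\<close>.\<close>

lemma hit_amp_first_passage:
  assumes "supported_right m \<psi>" "n < m"
  shows "hit_amp n t \<psi> = (\<Sum>k<t. hit_amp m k \<psi> * hit_amp n (t - Suc k) (ket m L))"
  using assms(1)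
proof (induction t arbitrary: \<psi>)
  case 0
  then show ?case
    using evolution_supported[OF 0, of "(n, L)"] assms(2) by (simp add: hit_amp_0)
next
  case (Suc t)
  \<comment> \<open>The part now at \<open>|m,L>\<close> gives the summand \<open>k = 0\<close>; the
    induction hypothesis for the rest gives the shifted summands.\<close>
  show ?case
    using Suc.IH[OF walk_step_supported[OF Suc.prems]]
    by (simp add: hit_amp_Suc walk_step_farther_boundary[OF Suc.prems assms(2)] hit_amp_linear
        sum.lessThan_Suc_shift del: sum.lessThan_Suc)
qed

section \<open>Translation invariance of the walk\<close>

definition translate :: "int \<Rightarrow> walk_state \<Rightarrow> walk_state" where
  "translate d \<psi> = (\<lambda>(m, c). \<psi> (m - d, c))"

lemma translate_ket: "translate d (ket m c) = ket (m + d) c"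
  by (auto simp: translate_def ket_def fun_eq_iff)

lemma evolution_translate: "evolution (translate d \<psi>) = translate d (evolution \<psi>)"
proof
  fix x show "evolution (translate d \<psi>) x = translate d (evolution \<psi>) x"
    by (cases x rule: shift_pos.cases)
      (simp_all add: translate_def evolution_simps coin_op_def algebra_simps)
qed

lemma walk_step_translate: "walk_step (n + d) (translate d \<psi>) = translate d (walk_step n \<psi>)"
  unfolding walk_step_def evolution_translate
  by (auto simp: proj_no_eq translate_def fun_eq_iff)

lemma hit_amp_translate: "hit_amp (n + d) t (translate d \<psi>) = hit_amp n t \<psi>"
  by (induction t arbitrary: \<psi>)
    (simp_all add: hit_amp_0 hit_amp_Suc evolution_translate walk_step_translate,
      simp add: translate_def)

lemma hit_gen_translate: "hit_gen (n + d) (translate d \<psi>) z = hit_gen n \<psi> z"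
  by (simp add: hit_gen_def hit_amp_translate)

section \<open>Norm bounds and convergence of the hitting series in the unit disc\<close>

lemma ell2_norm_nonneg: "ell2_norm \<psi> \<ge> 0"
  by (simp add: ell2_norm_def infsum_nonneg)

lemma ell2_norm_component:
  assumes "\<psi> \<in> ell2"
  shows "cmod (\<psi> x) \<le> ell2_norm \<psi>"
  unfolding ell2_norm_def
  using finite_sum_le_infsum[of "\<lambda>x. (cmod (\<psi> x))\<^sup>2" UNIV "{x}"] assms
  by (intro real_le_rsqrt) (auto simp: ell2_def)

lemma ell2_norm_proj_no:
  assumes "\<psi> \<in> ell2"
  shows "ell2_norm (proj_no n \<psi>) \<le> ell2_norm \<psi>"
  unfolding ell2_norm_def
  using assms proj_ell2(2)[OF assms, of n]
  by (intro real_sqrt_le_mono infsum_mono) (auto simp: ell2_def proj_no_eq)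

lemma ket_ell2: "ket m c \<in> ell2" and ell2_norm_ket: "ell2_norm (ket m c) = 1"
proof -
  have "((\<lambda>x. (cmod (ket m c x))\<^sup>2) has_sum 1) UNIV"
    by (rule has_sum_finite_neutralI[of "{(m, c)}"]) (auto simp: ket_def)
  then show "ket m c \<in> ell2" "ell2_norm (ket m c) = 1"
    by (auto simp: ell2_def ell2_norm_def infsumI dest: has_sum_imp_summable)
qed

lemma walk_step_ell2:
  assumes "\<psi> \<in> ell2"
  shows "walk_step n \<psi> \<in> ell2" and "ell2_norm (walk_step n \<psi>) \<le> ell2_norm \<psi>"
  using ell2_norm_proj_no[OF evolution_ell2(1)[OF assms], of n] evolution_ell2[OF assms]
  by (auto simp: walk_step_def proj_ell2)

text \<open>The evolution is isometric and the projection a contraction. The bound is uniform in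
  \<open>t\<close>, so a geometric series dominates the hitting series for
  \<open>|z| < 1\<close>.\<close>

lemma hit_amp_bound:
  assumes "\<psi> \<in> ell2"
  shows "cmod (hit_amp n t \<psi>) \<le> ell2_norm \<psi>"
  using assms
proof (induction t arbitrary: \<psi>)
  case 0
  then show ?case
    using ell2_norm_component[OF evolution_ell2(1)] evolution_ell2(2) by (metis hit_amp_0)
next
  case (Suc t)
  then show ?case
    using Suc.IH[OF walk_step_ell2(1)[OF Suc.prems, of n]] walk_step_ell2(2)[OF Suc.prems, of n]
    unfolding hit_amp_Suc by linarith
qed

lemma hit_gen_summable_norm:
  assumes "\<psi> \<in> ell2" "cmod z < 1"
  shows "summable (\<lambda>t. cmod (hit_amp n t \<psi> * z ^ Suc t))"
proof (rule summable_comparison_test')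
  show "summable (\<lambda>t. ell2_norm \<psi> * cmod z * cmod z ^ t)"
    using assms by (intro summable_mult summable_geometric) auto
  show "norm (cmod (hit_amp n t \<psi> * z ^ Suc t)) \<le> ell2_norm \<psi> * cmod z * cmod z ^ t" for t
    using hit_amp_bound[OF assms(1), of n t]
    by (simp add: norm_mult norm_power mult.assoc mult_right_mono)
qed

lemma hit_gen_sums:
  assumes "\<psi> \<in> ell2" "cmod z < 1"
  shows "(\<lambda>t. hit_amp n t \<psi> * z ^ Suc t) sums hit_gen n \<psi> z"
  unfolding hit_gen_def
  by (rule summable_sums[OF summable_norm_cancel[OF hit_gen_summable_norm[OF assms]]])

lemma hit_gen_linear:
  assumes "f \<in> ell2" "g \<in> ell2" "cmod z < 1"
    and "h = (\<lambda>x. a * f x + c * g x)"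
  shows "hit_gen n h z = a * hit_gen n f z + c * hit_gen n g z"
proof -
  have scale: "hit_amp n t (\<lambda>x. a * f x) = a * hit_amp n t f" for t a f
  proof -
    \<comment> \<open>Additivity with factor -1 writes the value at 0 as a difference of equal
      terms.\<close>
    have "hit_amp n t (\<lambda>x. 0) = 0"
      using hit_amp_linear[of n t "\<lambda>x. 0" "-1" "\<lambda>x. 0"] by simp
    then show ?thesis
      using hit_amp_linear[of n t "\<lambda>x. 0" a f] by simp
  qed
  have "hit_amp n t h = a * hit_amp n t f + c * hit_amp n t g" for t
    using hit_amp_linear[of n t "\<lambda>x. a * f x" c g] by (simp add: scale assms(4))
  then have "(\<lambda>t. hit_amp n t h * z ^ Suc t) =
      (\<lambda>t. a * (hit_amp n t f * z ^ Suc t) + c * (hit_amp n t g * z ^ Suc t))"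
    by (simp add: fun_eq_iff algebra_simps)
  moreover have "\<dots> sums (a * hit_gen n f z + c * hit_gen n g z)"
    by (intro sums_add sums_mult hit_gen_sums assms)
  ultimately show ?thesis
    by (simp add: hit_gen_def sums_iff)
qed

lemma hit_gen_first_step:
  assumes "\<psi> \<in> ell2" "cmod z < 1"
  shows "hit_gen n \<psi> z = z * (evolution \<psi> (n, L) + hit_gen n (walk_step n \<psi>) z)"
proof -
  have "(\<lambda>t. hit_amp n (Suc t) \<psi> * z ^ Suc (Suc t)) sums (z * hit_gen n (walk_step n \<psi>) z)"
    using sums_mult[OF hit_gen_sums[OF walk_step_ell2(1)[OF assms(1)] assms(2)], of z]
    by (simp add: hit_amp_Suc mult_ac)
  then have "(\<lambda>t. hit_amp n t \<psi> * z ^ Suc t) sums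
      (z * hit_gen n (walk_step n \<psi>) z + hit_amp n 0 \<psi> * z ^ Suc 0)"
    by (rule sums_Suc)
  then show ?thesis
    by (simp add: hit_gen_def sums_iff hit_amp_0 algebra_simps)
qed

text \<open>The first-passage convolution of amplitudes becomes a Cauchy product of series.\<close>

lemma hit_gen_first_passage:
  assumes "\<psi> \<in> ell2" "supported_right m \<psi>" "n < m" "cmod z < 1"
  shows "hit_gen n \<psi> z = hit_gen m \<psi> z * hit_gen n (ket m L) z"
proof -
  let ?a = "\<lambda>t. hit_amp m t \<psi> * z ^ Suc t" and ?b = "\<lambda>t. hit_amp n t (ket m L) * z ^ Suc t"
  have "(\<lambda>t. \<Sum>k\<le>t. ?a k * ?b (t - k)) sums (hit_gen m \<psi> z * hit_gen n (ket m L) z)"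
    unfolding hit_gen_def
    by (intro Cauchy_product_sums hit_gen_summable_norm ket_ell2 assms)
  \<comment> \<open>The two passages take \<open>k + 1\<close> and \<open>t - k + 1\<close> steps,
    \<open>t + 2\<close> in total, so the product gives the series from index 1 on. The missing term
    at index 0 vanishes because its convolution is empty.\<close>
  also have "(\<lambda>t. \<Sum>k\<le>t. ?a k * ?b (t - k)) = (\<lambda>t. hit_amp n (Suc t) \<psi> * z ^ Suc (Suc t))"
  proof
    fix t
    have "?a k * ?b (t - k) = hit_amp m k \<psi> * hit_amp n (t - k) (ket m L) * z ^ Suc (Suc t)"
      if "k \<le> t" for k
      using that by (simp add: power_add[symmetric] mult_ac)
    then show "(\<Sum>k\<le>t. ?a k * ?b (t - k)) = hit_amp n (Suc t) \<psi> * z ^ Suc (Suc t)"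
      unfolding hit_amp_first_passage[OF assms(2,3)] sum_distrib_right
      by (intro sum.cong) auto
  qed
  finally have "(\<lambda>t. hit_amp n t \<psi> * z ^ Suc t) sums
      (hit_gen m \<psi> z * hit_gen n (ket m L) z + hit_amp n 0 \<psi> * z ^ Suc 0)"
    by (rule sums_Suc)
  then show ?thesis
    using hit_amp_first_passage[OF assms(2,3), of 0] by (simp add: hit_gen_def sums_iff)
qed

section \<open>Generating functions at \<open>-M\<close> and the equations for \<open>l\<close>,
  \<open>s\<close>, \<open>r\<close>\<close>

lemma gen_fun_eq: "gen_fun c = hit_gen (- 1) (ket 0 c)"
proof -
  have "ell2_inner (ket (- 1) L) \<phi> = \<phi> (- 1, L)" for \<phi>
  proof -
    have "ell2_inner (ket (- 1) L) \<phi> = (\<Sum>\<^sub>\<infinity>x\<in>{(- 1, L)}. cnj (ket (- 1) L x) * \<phi> x)"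
      unfolding ell2_inner_def by (rule infsum_cong_neutral) (auto simp: ket_def)
    then show ?thesis by (simp add: ket_def)
  qed
  then show ?thesis
    by (simp add: gen_fun_def hit_gen_def hit_amp_def walk_step_def[abs_def] fun_eq_iff)
qed

lemma supported_right_ket: "n < m \<Longrightarrow> supported_right n (ket m c)"
  by (auto simp: supported_right_def ket_def)

text \<open>The walk always lives strictly to the right of the boundary before a step, so the "yes"
  outcome has a single nonzero coordinate, the one in state \<open>L\<close>.\<close>

lemma absorb_prob_eq:
  assumes "init_state \<alpha> \<beta> \<gamma> = ket 0 c" "M \<ge> 1"
  shows "absorb_prob M \<alpha> \<beta> \<gamma> = (\<Sum>t. (cmod (hit_amp (- int M) t (ket 0 c)))\<^sup>2)"
proof -
  have "(ell2_norm (proj_yes n (evolution \<phi>)))\<^sup>2 = (cmod (evolution \<phi> (n, L)))\<^sup>2"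
    if "supported_right n \<phi>" for n \<phi>
  proof -
    have "(\<Sum>\<^sub>\<infinity>x. (cmod (proj_yes n (evolution \<phi>) x))\<^sup>2) =
        (\<Sum>\<^sub>\<infinity>x\<in>{(n, L)}. (cmod (proj_yes n (evolution \<phi>) x))\<^sup>2)"
      using evolution_supported[OF that, of "(n, _)"]
      by (intro infsum_cong_neutral) (force simp: proj_yes_def split: if_splits)+
    then show ?thesis
      by (simp add: ell2_norm_def proj_yes_def)
  qed
  moreover have "supported_right (- int M) ((walk_step (- int M) ^^ t) (ket 0 c))" for t
    using assms(2) by (intro funpow_walk_step_supported supported_right_ket) simp
  ultimately show ?thesis
    unfolding absorb_prob_def assms(1) hit_amp_def walk_step_def[abs_def] by simp
qed

text \<open>Passage through -1 leaves the state \<open>|-1,L>\<close>, which translates to a start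
  in \<open>|0,L>\<close> with the boundary one site nearer. The coin is general in the induction
  because the hypothesis is applied with \<open>L\<close>.\<close>

lemma hit_gen_power:
  assumes "cmod z < 1"
  shows "hit_gen (- int (Suc M)) (ket 0 c) z = gen_fun c z * gen_fun L z ^ M"
proof (induction M arbitrary: c)
  case 0
  then show ?case by (simp add: gen_fun_eq)
next
  case (Suc M)
  have "hit_gen (- int (Suc (Suc M))) (ket 0 c) z =
      hit_gen (- 1) (ket 0 c) z * hit_gen (- int (Suc (Suc M))) (ket (- 1) L) z"
    by (intro hit_gen_first_passage ket_ell2 supported_right_ket assms) auto
  also have "hit_gen (- int (Suc (Suc M))) (ket (- 1) L) z = hit_gen (- int (Suc M)) (ket 0 L) z"
    using hit_gen_translate[of "- int (Suc M)" "- 1" "ket 0 L" z] by (simp add: translate_ket)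
  finally show ?case
    using Suc.IH[of L] by (simp add: gen_fun_eq)
qed

text \<open>One step from 0 is absorbed, stays at 0 in state \<open>S\<close>, or goes to 1 in state
  \<open>R\<close>. From 1 the boundary is two sites away, which contributes the product
  \<open>r l\<close>.\<close>

lemma gen_fun_first_step:
  assumes "cmod z < 1"
  shows "gen_fun c z =
    z * (grover L c + grover S c * gen_fun S z + grover R c * (gen_fun R z * gen_fun L z))"
proof -
  have step: "walk_step (- 1) (ket 0 c) = (\<lambda>x. grover S c * ket 0 S x + grover R c * ket 1 R x)"
  proof
    fix x show "walk_step (- 1) (ket 0 c) x = grover S c * ket 0 S x + grover R c * ket 1 R x"
      by (cases x rule: shift_pos.cases; cases c)
        (auto simp: walk_step_def proj_no_eq evolution_simps coin_op_def ket_def UNIV_coin)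
  qed
  have hit: "evolution (ket 0 c) (- 1, L) = grover L c"
    by (cases c) (auto simp: evolution_simps coin_op_def ket_def UNIV_coin)
  have "hit_gen (- 1) (ket 1 R) z = gen_fun R z * gen_fun L z"
    using hit_gen_translate[of "- 2" 1 "ket 0 R" z] hit_gen_power[OF assms, of 1 R]
    by (simp add: translate_ket)
  then show ?thesis
    using hit_gen_first_step[OF ket_ell2 assms, of "- 1" 0 c]
      hit_gen_linear[OF ket_ell2 ket_ell2 assms step, of "- 1"]
    by (simp add: gen_fun_eq hit add.assoc)
qed

lemma gen_fun_0: "gen_fun c 0 = 0"
  using gen_fun_first_step[of 0 c] by simp

text \<open>On the disc the function is \<open>z\<close> times a power series with coefficients of
  modulus at most 1.\<close>

lemma continuous_on_gen_fun: "continuous_on (ball 0 1) (gen_fun c)"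
proof -
  let ?a = "\<lambda>t. hit_amp (- 1) t (ket 0 c)"
  have summ: "summable (\<lambda>t. ?a t * z ^ t)" if "cmod z < 1" for z
  proof (rule summable_comparison_test')
    show "summable (\<lambda>t. cmod z ^ t)"
      using that by (intro summable_geometric) auto
    show "cmod (?a t * z ^ t) \<le> cmod z ^ t" for t
      using hit_amp_bound[OF ket_ell2, of "- 1" t 0 c]
      by (simp add: ell2_norm_ket norm_mult norm_power mult_left_le_one_le)
  qed
  have "isCont (\<lambda>z. \<Sum>t. ?a t * z ^ t) z" if z: "cmod z < 1" for z
  proof (rule isCont_powser)
    show "summable (\<lambda>t. ?a t * of_real ((cmod z + 1) / 2) ^ t)"
      using z by (intro summ) (simp del: of_real_add of_real_divide)
    show "cmod z < cmod (of_real ((cmod z + 1) / 2) :: complex)"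
      using z by (simp del: of_real_add of_real_divide)
  qed
  then have "continuous_on (ball 0 1) (\<lambda>z. z * (\<Sum>t. ?a t * z ^ t))"
    by (intro continuous_intros continuous_at_imp_continuous_on) auto
  then show ?thesis
  proof (rule continuous_on_eq)
    fix z :: complex assume "z \<in> ball 0 1"
    then show "z * (\<Sum>t. ?a t * z ^ t) = gen_fun c z"
      using sums_mult[OF summable_sums[OF summ[of z]], of z]
      by (simp add: gen_fun_eq hit_gen_def sums_iff mult_ac)
  qed
qed

section \<open>Roots of the quadratic for \<open>r l\<close>\<close>

text \<open>The cluster set of a continuous function along a ray is connected, so a function that
  approaches the finite set \<open>{a, b}\<close> has a limit.\<close>

lemma tendsto_root_of_quadratic:
  fixes f :: "real \<Rightarrow> complex"
  assumes cont: "continuous_on {0<..<1} f"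
    and prod: "((\<lambda>\<rho>. (f \<rho> - a) * (f \<rho> - b)) \<longlongrightarrow> 0) (at_left 1)"
  shows "\<exists>l. (f \<longlongrightarrow> l) (at_left 1)"
proof (cases "a = b")
  case True
  \<comment> \<open>For a double root the product is a square, so a square root recovers the
    distance to \<open>a\<close>.\<close>
  have "((\<lambda>\<rho>. sqrt (cmod ((f \<rho> - a) * (f \<rho> - b)))) \<longlongrightarrow> sqrt 0) (at_left 1)"
    using tendsto_norm_zero[OF prod] by (intro tendsto_real_sqrt)
  then have "((\<lambda>\<rho>. cmod (f \<rho> - a)) \<longlongrightarrow> 0) (at_left 1)"
    by (simp add: True norm_mult)
  then show ?thesis
    by (metis Lim_null tendsto_norm_zero_iff)
next
  case False
  \<comment> \<open>With \<open>d\<close> half the distance between the roots, no point is closer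
    than \<open>d\<close> to both of them.\<close>
  define d where "d = cmod (a - b) / 2"
  have d: "d > 0" using False by (simp add: d_def)
  have far: "2 * d \<le> cmod (w - a) + cmod (w - b)" for w
    using norm_triangle_ineq4[of "w - a" "w - b"] by (simp add: d_def norm_minus_commute)
  have "\<forall>\<^sub>F \<rho> in at_left 1. cmod ((f \<rho> - a) * (f \<rho> - b)) < d * d"
    using order_tendstoD(2)[OF tendsto_norm_zero[OF prod]] d by simp
  then obtain r where r: "r < 1" and small: "\<And>\<rho>. r < \<rho> \<Longrightarrow> \<rho> < 1 \<Longrightarrow> cmod (f \<rho> - a) * cmod (f \<rho> - b) < d * d"
    unfolding eventually_at_left_field norm_mult by blast
  define I where "I = {max r 0<..<1}"
  have smallI: "cmod (f \<rho> - a) * cmod (f \<rho> - b) < d * d" if "\<rho> \<in> I" for \<rho>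
    using that by (intro small) (auto simp: I_def)
  have ev_I: "\<forall>\<^sub>F \<rho> in at_left 1. \<rho> \<in> I"
    unfolding I_def using r by (intro eventually_at_left_field[THEN iffD2]) (auto intro!: exI[of _ "max r 0"])
  have conv: "(f \<longlongrightarrow> u) (at_left 1)"
    if lim: "((\<lambda>\<rho>. (f \<rho> - u) * (f \<rho> - v)) \<longlongrightarrow> 0) (at_left 1)" and v: "\<forall>\<rho>\<in>I. d < cmod (f \<rho> - v)" for u v
  proof -
    have "((\<lambda>\<rho>. f \<rho> - u) \<longlongrightarrow> 0) (at_left 1)"
    proof (rule Lim_null_comparison)
      have "((\<lambda>\<rho>. cmod ((f \<rho> - u) * (f \<rho> - v)) / d) \<longlongrightarrow> 0 / d) (at_left 1)"
        using d by (intro tendsto_divide tendsto_norm_zero lim tendsto_const) auto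
      then show "((\<lambda>\<rho>. cmod ((f \<rho> - u) * (f \<rho> - v)) / d) \<longlongrightarrow> 0) (at_left 1)" by simp
      show "\<forall>\<^sub>F \<rho> in at_left 1. cmod (f \<rho> - u) \<le> cmod ((f \<rho> - u) * (f \<rho> - v)) / d"
        using ev_I
      proof eventually_elim
        case (elim \<rho>)
        then have "cmod (f \<rho> - u) * d \<le> cmod (f \<rho> - u) * cmod (f \<rho> - v)"
          using v by (intro mult_left_mono) auto
        then show ?case using d by (simp add: norm_mult pos_le_divide_eq)
      qed
    qed
    then show ?thesis by (simp add: Lim_null[symmetric])
  qed
  \<comment> \<open>A point on the circle of radius \<open>d\<close> about \<open>a\<close> is at
    least \<open>d\<close> away from \<open>b\<close>, which would make the product at least
    \<open>d * d\<close>. By connectedness \<open>f\<close> therefore stays on one side of this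
    circle.\<close>
  have ne: "cmod (f \<rho> - a) \<noteq> d" if "\<rho> \<in> I" for \<rho>
  proof
    assume eq: "cmod (f \<rho> - a) = d"
    then have "d \<le> cmod (f \<rho> - b)" using far[of "f \<rho>"] by linarith
    then have "d * d \<le> d * cmod (f \<rho> - b)" using d by (intro mult_left_mono) auto
    with smallI[OF that] show False by (simp add: eq)
  qed
  have "connected ((\<lambda>\<rho>. cmod (f \<rho> - a)) ` I)"
    unfolding I_def
    by (intro connected_continuous_image continuous_intros continuous_on_subset[OF cont]) auto
  then have "is_interval ((\<lambda>\<rho>. cmod (f \<rho> - a)) ` I)"
    by (simp add: is_interval_connected_1)
  then have "(\<forall>\<rho>\<in>I. cmod (f \<rho> - a) < d) \<or> (\<forall>\<rho>\<in>I. d < cmod (f \<rho> - a))"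
  proof -
    have "d \<in> (\<lambda>\<rho>. cmod (f \<rho> - a)) ` I"
      if "\<rho> \<in> I" "\<sigma> \<in> I" "cmod (f \<rho> - a) \<le> d" "d \<le> cmod (f \<sigma> - a)" for \<rho> \<sigma>
      using \<open>is_interval _\<close> that unfolding is_interval_1 by blast
    then show ?thesis
      using ne by (force simp: not_less)
  qed
  then show ?thesis
  proof
    assume "\<forall>\<rho>\<in>I. cmod (f \<rho> - a) < d"
    moreover have "d < cmod (f \<rho> - b)" if "cmod (f \<rho> - a) < d" for \<rho>
      using far[of "f \<rho>"] that by linarith
    ultimately have "\<forall>\<rho>\<in>I. d < cmod (f \<rho> - b)" by blast
    then show ?thesis using conv[OF prod] by blast
  next
    assume "\<forall>\<rho>\<in>I. d < cmod (f \<rho> - a)"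
    then show ?thesis using conv[of b a] prod by (auto simp: mult.commute)
  qed
qed

lemma quadratic_factorization:
  fixes w :: complex
  obtains a b where "\<And>x. x\<^sup>2 + w * x + 1 = (x - a) * (x - b)"
proof -
  define q where "q = csqrt (w\<^sup>2 - 4)"
  have q: "q\<^sup>2 = w\<^sup>2 - 4" by (simp add: q_def)
  have "x\<^sup>2 + w * x + 1 = (x - (- w + q) / 2) * (x - (- w - q) / 2)" for x
  proof -
    have "4 * ((x - (- w + q) / 2) * (x - (- w - q) / 2)) = (2 * x + w)\<^sup>2 - q\<^sup>2"
      by (simp add: power2_eq_square field_simps)
    also have "\<dots> = 4 * (x\<^sup>2 + w * x + 1)"
      unfolding q by (simp add: power2_eq_square algebra_simps)
    finally show ?thesis
      by (metis mult_cancel_left zero_neq_numeral)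
  qed
  then show ?thesis using that by blast
qed

text \<open>If \<open>a\<close>, \<open>b\<close> are the roots of the limiting quadratic,
  subtracting the equation for \<open>f\<close> leaves \<open>(f - a) (f - b) = (w1 - w) f\<close>,
  which tends to 0 since \<open>f\<close> is bounded.\<close>

lemma radial_limit_of_root:
  fixes f w :: "real \<Rightarrow> complex"
  assumes cont: "continuous_on {0<..<1} f"
    and root: "\<And>\<rho>. 0 < \<rho> \<Longrightarrow> \<rho> < 1 \<Longrightarrow> (f \<rho>)\<^sup>2 + w \<rho> * f \<rho> + 1 = 0"
    and bound: "\<And>\<rho>. 0 < \<rho> \<Longrightarrow> \<rho> < 1 \<Longrightarrow> cmod (f \<rho>) \<le> C"
    and w: "(w \<longlongrightarrow> w1) (at_left 1)"
  shows "\<exists>l. (f \<longlongrightarrow> l) (at_left 1)"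
proof -
  obtain a b where ab: "\<And>x. x\<^sup>2 + w1 * x + 1 = (x - a) * (x - b)"
    using quadratic_factorization by blast
  have ev: "\<forall>\<^sub>F \<rho> in at_left 1. 0 < \<rho> \<and> \<rho> < (1::real)"
    by (intro eventually_at_left_field[THEN iffD2]) (auto intro!: exI[of _ 0])
  have "((\<lambda>\<rho>. (f \<rho> - a) * (f \<rho> - b)) \<longlongrightarrow> 0) (at_left 1)"
  proof (rule Lim_null_comparison)
    show "\<forall>\<^sub>F \<rho> in at_left 1. cmod ((f \<rho> - a) * (f \<rho> - b)) \<le> cmod (w1 - w \<rho>) * C"
      using ev
    proof eventually_elim
      case (elim \<rho>)
      have "(f \<rho> - a) * (f \<rho> - b) = (w1 - w \<rho>) * f \<rho> + ((f \<rho>)\<^sup>2 + w \<rho> * f \<rho> + 1)"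
        unfolding ab[symmetric] by (simp add: algebra_simps)
      then have "(f \<rho> - a) * (f \<rho> - b) = (w1 - w \<rho>) * f \<rho>"
        using root elim by simp
      then show ?case
        using bound elim by (auto simp: norm_mult intro!: mult_left_mono)
    qed
    have "((\<lambda>\<rho>. cmod (w1 - w \<rho>) * C) \<longlongrightarrow> cmod (w1 - w1) * C) (at_left 1)"
      by (intro tendsto_intros w)
    then show "((\<lambda>\<rho>. cmod (w1 - w \<rho>) * C) \<longlongrightarrow> 0) (at_left 1)" by simp
  qed
  with cont show ?thesis by (rule tendsto_root_of_quadratic)
qed

text \<open>For unimodular \<open>p\<close> the equation, read as a quadratic in \<open>z\<close>,
  forces \<open>|z| = 3 / sqrt (1 + 4 y\<^sup>2)\<close> with
  \<open>y\<^sup>2 = 1 + Re p \<le> 2\<close>, hence \<open>|z| \<ge> 1\<close>.\<close>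

lemma grover_quadratic_root_not_unimodular:
  fixes z p :: complex
  assumes "cmod z < 1" and eq: "2 * z\<^sup>2 * p\<^sup>2 + (5 * z\<^sup>2 + 6 * z + 9) * p + 2 * z\<^sup>2 = 0"
  shows "cmod p \<noteq> 1"
proof
  assume p: "cmod p = 1"
  then have pp: "p * cnj p = 1" by (simp add: complex_norm_square[symmetric])
  define y where "y = sqrt (1 + Re p)"
  have Rep: "Re p \<le> 1" "- 1 \<le> Re p"
    using abs_Re_le_cmod[of p] p by auto
  then have y: "y\<^sup>2 = 1 + Re p" by (simp add: y_def)
  \<comment> \<open>Since \<open>1 / p = cnj p\<close>, dividing the equation by \<open>p\<close> gives \<open>(z + 3)\<^sup>2 = - (2 y z)\<^sup>2\<close> with \<open>y\<close> real.\<close>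
  have "cnj p * (2 * z\<^sup>2 * p\<^sup>2 + (5 * z\<^sup>2 + 6 * z + 9) * p + 2 * z\<^sup>2) =
      2 * z\<^sup>2 * ((p * cnj p) * p) + (5 * z\<^sup>2 + 6 * z + 9) * (p * cnj p) + 2 * z\<^sup>2 * cnj p"
    by (simp add: power2_eq_square algebra_simps)
  then have "0 = 2 * z\<^sup>2 * (p + cnj p) + (5 * z\<^sup>2 + 6 * z + 9)"
    unfolding eq pp by (simp add: algebra_simps)
  also have "p + cnj p = 2 * (of_real y)\<^sup>2 - 2"
    by (simp add: complex_add_cnj y flip: of_real_power)
  also have "2 * z\<^sup>2 * (2 * (of_real y)\<^sup>2 - 2) + (5 * z\<^sup>2 + 6 * z + 9) =
      (3 + z * (1 + 2 * \<i> * of_real y)) * (3 + z * (1 - 2 * \<i> * of_real y))"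
    by (simp add: power2_eq_square algebra_simps)
  finally have "z * (1 + 2 * \<i> * of_real y) = - 3 \<or> z * (1 - 2 * \<i> * of_real y) = - 3"
    by (auto simp: add_eq_0_iff)
  then have "cmod (z * (1 + 2 * \<i> * of_real y)) = 3 \<or> cmod (z * (1 - 2 * \<i> * of_real y)) = 3"
    by auto
  moreover have "cmod (1 + 2 * \<i> * of_real y) = sqrt (1 + 4 * y\<^sup>2)"
    "cmod (1 - 2 * \<i> * of_real y) = sqrt (1 + 4 * y\<^sup>2)"
    by (simp_all add: cmod_def power_mult_distrib)
  ultimately have "cmod z * sqrt (1 + 4 * y\<^sup>2) = 3"
    by (auto simp: norm_mult)
  moreover have "sqrt (1 + 4 * y\<^sup>2) \<le> 3"
    using Rep by (intro real_le_lsqrt) (auto simp: y)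
  then have "cmod z * sqrt (1 + 4 * y\<^sup>2) \<le> cmod z * 3"
    by (intro mult_left_mono) auto
  ultimately show False using assms(1) by simp
qed

text \<open>The values of \<open>|p|\<close> on the disc form an interval that contains 0 and omits
  1.\<close>

lemma grover_quadratic_continuous_root_bound:
  fixes p :: "complex \<Rightarrow> complex"
  assumes cont: "continuous_on (ball 0 1) p" and "p 0 = 0"
    and eq: "\<And>z. cmod z < 1 \<Longrightarrow>
      2 * z\<^sup>2 * (p z)\<^sup>2 + (5 * z\<^sup>2 + 6 * z + 9) * p z + 2 * z\<^sup>2 = 0"
    and z: "cmod z < 1"
  shows "cmod (p z) < 1"
proof (rule ccontr)
  assume "\<not> cmod (p z) < 1"
  moreover have "is_interval ((\<lambda>z. cmod (p z)) ` ball 0 1)"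
    unfolding is_interval_connected_1
    by (intro connected_continuous_image continuous_intros cont connected_ball)
  moreover have "cmod (p 0) \<in> (\<lambda>z. cmod (p z)) ` ball 0 1" "cmod (p z) \<in> (\<lambda>z. cmod (p z)) ` ball 0 1"
    using z by auto
  ultimately have "1 \<in> (\<lambda>z. cmod (p z)) ` ball 0 1"
    using \<open>p 0 = 0\<close> unfolding is_interval_1 by (metis norm_zero not_less zero_le_one)
  then show False
    using grover_quadratic_root_not_unimodular[OF _ eq] by auto
qed

section \<open>Boundary values of the generating functions\<close>

text \<open>With \<open>p = r l\<close> as a parameter the one-step equations are linear: the second
  determines \<open>s\<close>, and then the others give \<open>l\<close> and \<open>r\<close>.
  Multiplying these two closes the system in an equation for \<open>p\<close> alone.\<close>

lemma gen_fun_formulas: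
  assumes z: "cmod z < 1"
  defines "p \<equiv> gen_fun R z * gen_fun L z"
  shows "gen_fun L z = z * ((z - 1) + 2 * (1 + z) * p) / (3 + z)"
    and "gen_fun S z = z * (2 * (1 + p)) / (3 + z)"
    and "gen_fun R z = z * (2 * (1 + z) + (z - 1) * p) / (3 + z)"
    and "2 * z\<^sup>2 * p\<^sup>2 + (5 * z\<^sup>2 + 6 * z + 9) * p + 2 * z\<^sup>2 = 0"
proof -
  let ?l = "gen_fun L z" and ?s = "gen_fun S z" and ?r = "gen_fun R z"
  have eqs: "3 * ?l = z * (- 1 + 2 * ?s + 2 * p)" "3 * ?s = z * (2 - ?s + 2 * p)"
    "3 * ?r = z * (2 + 2 * ?s - p)"
  proof -
    have "3 * gen_fun c z = z * (3 * grover L c + (3 * grover S c) * ?s + (3 * grover R c) * p)" for c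
      unfolding p_def using gen_fun_first_step[OF z, of c] by algebra
    from this[of L] this[of S] this[of R] show "3 * ?l = z * (- 1 + 2 * ?s + 2 * p)"
      "3 * ?s = z * (2 - ?s + 2 * p)" "3 * ?r = z * (2 + 2 * ?s - p)"
      by (simp_all add: grover_def)
  qed
  have nz: "3 + z \<noteq> 0"
  proof
    assume "3 + z = 0"
    then have "cmod z = cmod (- 3)" by (simp only: add_eq_0_iff)
    with z show False by simp
  qed
  have s: "?s * (3 + z) = z * (2 * (1 + p))"
    using eqs(2) by (simp add: algebra_simps)
  have "3 * (?l * (3 + z)) = z * (- (3 + z) + 2 * (?s * (3 + z)) + 2 * p * (3 + z))"
    using eqs(1) by algebra
  then have l: "?l * (3 + z) = z * ((z - 1) + 2 * (1 + z) * p)"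
    unfolding s by algebra
  have "3 * (?r * (3 + z)) = z * (2 * (3 + z) + 2 * (?s * (3 + z)) - p * (3 + z))"
    using eqs(3) by algebra
  then have r: "?r * (3 + z) = z * (2 * (1 + z) + (z - 1) * p)"
    unfolding s by algebra
  show "?l = z * ((z - 1) + 2 * (1 + z) * p) / (3 + z)" "?s = z * (2 * (1 + p)) / (3 + z)"
    "?r = z * (2 * (1 + z) + (z - 1) * p) / (3 + z)"
    using l s r nz by (simp_all add: eq_divide_eq)
  have "p * (3 + z)\<^sup>2 = (?r * (3 + z)) * (?l * (3 + z))"
    by (simp add: p_def power2_eq_square mult_ac)
  \<comment> \<open>The closed equation carries the extra factor \<open>z\<^sup>2 - 1\<close>, which
    has no zero in the open disc.\<close>
  then have "(z\<^sup>2 - 1) * (2 * z\<^sup>2 * p\<^sup>2 + (5 * z\<^sup>2 + 6 * z + 9) * p + 2 * z\<^sup>2) = 0"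
    unfolding l r by algebra
  moreover have "z\<^sup>2 \<noteq> 1"
    using z by (auto simp: power2_eq_1_iff)
  ultimately show "2 * z\<^sup>2 * p\<^sup>2 + (5 * z\<^sup>2 + 6 * z + 9) * p + 2 * z\<^sup>2 = 0"
    by simp
qed

lemma gen_fun_R_L_bound:
  assumes "cmod z < 1"
  shows "cmod (gen_fun R z * gen_fun L z) < 1"
proof (rule grover_quadratic_continuous_root_bound[of "\<lambda>z. gen_fun R z * gen_fun L z"])
  show "continuous_on (ball 0 1) (\<lambda>z. gen_fun R z * gen_fun L z)"
    by (intro continuous_intros continuous_on_gen_fun)
qed (use gen_fun_formulas(4) gen_fun_0 assms in auto)

text \<open>In the rational formulas the numerators are at most 6 in modulus, by
  \<open>|p| \<le> 1\<close>, and the denominator \<open>3 + z\<close> is at least 2.\<close>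

lemma gen_fun_bound:
  assumes z: "cmod z < 1"
  shows "cmod (gen_fun c z) \<le> 3"
proof -
  define p where "p = gen_fun R z * gen_fun L z"
  have p: "cmod p \<le> 1"
    using gen_fun_R_L_bound[OF z] by (simp add: p_def)
  have plus: "cmod (1 + z) \<le> 2" and minus: "cmod (z - 1) \<le> 2" and p1: "cmod (1 + p) \<le> 2"
    using norm_triangle_ineq[of 1 z] norm_triangle_ineq4[of z 1] norm_triangle_ineq[of 1 p] z p by simp_all
  have three: "2 \<le> cmod (3 + z)"
    using norm_triangle_ineq2[of 3 "- z"] z by simp
  have quot: "cmod (z * N / (3 + z)) \<le> 3" if "cmod N \<le> 6" for N
  proof -
    have "cmod (z * N) \<le> 1 * 6"
      unfolding norm_mult using z that by (intro mult_mono) auto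
    also have "\<dots> \<le> 3 * cmod (3 + z)" using three by simp
    finally show ?thesis
      using three by (simp add: norm_divide divide_le_eq)
  qed
  have mp: "cmod (x * p) \<le> cmod x" for x
    using p by (simp add: norm_mult mult_left_le)
  have plus2: "cmod (2 * (1 + z)) \<le> 4"
    using plus by (simp only: norm_mult norm_numeral)
  have "cmod ((z - 1) + 2 * (1 + z) * p) \<le> 6"
    using norm_triangle_ineq[of "z - 1" "2 * (1 + z) * p"] mp[of "2 * (1 + z)"] plus2 minus
    by linarith
  moreover have "cmod (2 * (1 + p)) \<le> 6"
    using p1 by (simp only: norm_mult norm_numeral)
  moreover have "cmod (2 * (1 + z) + (z - 1) * p) \<le> 6"
    using norm_triangle_ineq[of "2 * (1 + z)" "(z - 1) * p"] mp[of "z - 1"] plus2 minus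
    by linarith
  ultimately show ?thesis
    using gen_fun_formulas(1-3)[OF z, folded p_def] by (cases c) (simp_all only: quot)
qed

text \<open>\<open>boundary_value\<close> is given by \<open>Lim\<close>, so the existence of the
  limit is the point. It is proved for \<open>p = r l\<close> from the quadratic and transferred by
  the rational formulas.\<close>

lemma gen_fun_radial_limit:
  "((\<lambda>\<rho>. gen_fun c (of_real \<rho> * cis \<theta>)) \<longlongrightarrow> boundary_value (gen_fun c) \<theta>) (at_left 1)"
proof -
  define \<zeta> where "\<zeta> \<rho> = of_real \<rho> * cis \<theta>" for \<rho> :: real
  define p where "p \<rho> = gen_fun R (\<zeta> \<rho>) * gen_fun L (\<zeta> \<rho>)" for \<rho>
  have \<zeta>: "cmod (\<zeta> \<rho>) < 1" "\<zeta> \<rho> \<noteq> 0" if "0 < \<rho>" "\<rho> < 1" for \<rho>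
    using that by (auto simp: \<zeta>_def norm_mult)
  have \<zeta>_cont: "continuous_on A \<zeta>" for A
    unfolding \<zeta>_def by (intro continuous_intros)
  have "(\<zeta> \<longlongrightarrow> of_real 1 * cis \<theta>) (at_left 1)"
    unfolding \<zeta>_def by (intro tendsto_intros)
  then have \<zeta>_lim: "(\<zeta> \<longlongrightarrow> cis \<theta>) (at_left 1)" by simp
  have "\<exists>P. (p \<longlongrightarrow> P) (at_left 1)"
  proof (rule radial_limit_of_root)
    have "continuous_on {0<..<1} (\<lambda>\<rho>. gen_fun c (\<zeta> \<rho>))" for c
      using \<zeta> by (intro continuous_on_compose2[OF continuous_on_gen_fun \<zeta>_cont]) auto
    then show "continuous_on {0<..<1} p"
      unfolding p_def by (intro continuous_intros)
    \<comment> \<open>Dividing the quadratic by \<open>2 * z\<^sup>2\<close> makes it monic with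
      constant term 1; this is legitimate along the ray away from 0 and at its endpoint.\<close>
    let ?w = "\<lambda>z. (5 * z\<^sup>2 + 6 * z + 9) / (2 * z\<^sup>2) :: complex"
    show "((\<lambda>\<rho>. ?w (\<zeta> \<rho>)) \<longlongrightarrow> ?w (cis \<theta>)) (at_left 1)"
      by (intro tendsto_intros \<zeta>_lim) auto
    show "(p \<rho>)\<^sup>2 + ?w (\<zeta> \<rho>) * p \<rho> + 1 = 0" if "0 < \<rho>" "\<rho> < 1" for \<rho>
    proof -
      have "2 * (\<zeta> \<rho>)\<^sup>2 * ((p \<rho>)\<^sup>2 + ?w (\<zeta> \<rho>) * p \<rho> + 1) =
          2 * (\<zeta> \<rho>)\<^sup>2 * (p \<rho>)\<^sup>2 + (5 * (\<zeta> \<rho>)\<^sup>2 + 6 * \<zeta> \<rho> + 9) * p \<rho> + 2 * (\<zeta> \<rho>)\<^sup>2"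
        using \<zeta>(2)[OF that] by (simp add: distrib_left)
      also have "\<dots> = 0"
        unfolding p_def by (rule gen_fun_formulas(4)[OF \<zeta>(1)[OF that]])
      finally show ?thesis
        using \<zeta>(2)[OF that] by simp
    qed
    show "cmod (p \<rho>) \<le> 1" if "0 < \<rho>" "\<rho> < 1" for \<rho>
      using gen_fun_R_L_bound[OF \<zeta>(1)[OF that]] by (simp add: p_def)
  qed
  then obtain P where P: "(p \<longlongrightarrow> P) (at_left 1)" ..
  have nz: "3 + cis \<theta> \<noteq> 0"
  proof
    assume "3 + cis \<theta> = 0"
    then have "cmod (cis \<theta>) = cmod (- 3)" by (simp only: add_eq_0_iff)
    then show False by simp
  qed
  have quot: "\<exists>g. ((\<lambda>\<rho>. \<zeta> \<rho> * N \<rho> / (3 + \<zeta> \<rho>)) \<longlongrightarrow> g) (at_left 1)" if "(N \<longlongrightarrow> n) (at_left 1)" for N n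
    by (rule exI, rule tendsto_divide[OF tendsto_mult[OF \<zeta>_lim that] tendsto_add[OF tendsto_const \<zeta>_lim] nz])
  have ev: "\<forall>\<^sub>F \<rho> in at_left 1. 0 < \<rho> \<and> \<rho> < (1::real)"
    by (intro eventually_at_left_field[THEN iffD2]) (auto intro!: exI[of _ 0])
  have formulas: "\<forall>\<^sub>F \<rho> in at_left 1.
      gen_fun L (\<zeta> \<rho>) = \<zeta> \<rho> * ((\<zeta> \<rho> - 1) + 2 * (1 + \<zeta> \<rho>) * p \<rho>) / (3 + \<zeta> \<rho>)"
    "\<forall>\<^sub>F \<rho> in at_left 1. gen_fun S (\<zeta> \<rho>) = \<zeta> \<rho> * (2 * (1 + p \<rho>)) / (3 + \<zeta> \<rho>)"
    "\<forall>\<^sub>F \<rho> in at_left 1.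
      gen_fun R (\<zeta> \<rho>) = \<zeta> \<rho> * (2 * (1 + \<zeta> \<rho>) + (\<zeta> \<rho> - 1) * p \<rho>) / (3 + \<zeta> \<rho>)"
    unfolding p_def by (rule eventually_mono[OF ev], rule gen_fun_formulas, simp add: \<zeta>)+
  have "\<exists>g. ((\<lambda>\<rho>. gen_fun c (\<zeta> \<rho>)) \<longlongrightarrow> g) (at_left 1)"
  proof (cases c)
    case L
    show ?thesis
      unfolding L tendsto_cong[OF formulas(1)]
      by (rule quot[where n = "(cis \<theta> - 1) + 2 * (1 + cis \<theta>) * P"]) (intro tendsto_intros \<zeta>_lim P)
  next
    case S
    show ?thesis
      unfolding S tendsto_cong[OF formulas(2)]
      by (rule quot[where n = "2 * (1 + P)"]) (intro tendsto_intros \<zeta>_lim P)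
  next
    case R
    show ?thesis
      unfolding R tendsto_cong[OF formulas(3)]
      by (rule quot[where n = "2 * (1 + cis \<theta>) + (cis \<theta> - 1) * P"]) (intro tendsto_intros \<zeta>_lim P)
  qed
  then obtain g where g: "((\<lambda>\<rho>. gen_fun c (of_real \<rho> * cis \<theta>)) \<longlongrightarrow> g) (at_left 1)"
    unfolding \<zeta>_def by blast
  moreover have "boundary_value (gen_fun c) \<theta> = g"
    unfolding boundary_value_def by (rule tendsto_Lim[OF _ g]) simp
  ultimately show ?thesis by simp
qed

section \<open>Parseval's identity applied to the hitting amplitudes at \<open>-M\<close>\<close>

lemma absorb_prob_integral:
  assumes "M \<ge> 1" "init_state \<alpha> \<beta> \<gamma> = ket 0 c"
  shows "absorb_prob M \<alpha> \<beta> \<gamma> = 1 / (2 * pi) * integral {0..2 * pi}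
    (\<lambda>\<theta>. (cmod (boundary_value (gen_fun c) \<theta>))\<^sup>2 * cmod (L_bdry \<theta>) ^ (2 * M - 2))"
proof -
  obtain N where M: "M = Suc N" using assms(1) by (cases M) auto
  let ?a = "\<lambda>t. hit_amp (- int M) t (ket 0 c)"
  let ?G = "\<lambda>\<theta>. boundary_value (gen_fun c) \<theta> * L_bdry \<theta> ^ N"
  \<comment> \<open>The hitting series starts with \<open>z ^ 1\<close>, so a zero coefficient is
    put in front; the sum of squares is unchanged.\<close>
  have "(\<lambda>t. (cmod (case_nat 0 ?a t))\<^sup>2) sums
      (1 / (2 * pi) * integral {0..2 * pi} (\<lambda>\<theta>. (cmod (?G \<theta>))\<^sup>2))"
  proof (rule bounded_power_series_parseval)
    fix z :: complex assume z: "cmod z < 1"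
    show "(\<lambda>t. case_nat 0 ?a t * z ^ t) sums (gen_fun c z * gen_fun L z ^ N)"
      using sums_Suc[of "\<lambda>t. case_nat 0 ?a t * z ^ t"] hit_gen_sums[OF ket_ell2 z, of "- int M" 0 c]
        hit_gen_power[OF z, of N c]
      by (simp add: M)
    show "cmod (gen_fun c z * gen_fun L z ^ N) \<le> 3 * 3 ^ N"
      unfolding norm_mult norm_power using gen_fun_bound[OF z]
      by (intro mult_mono power_mono) auto
  next
    fix \<theta>
    show "((\<lambda>\<rho>. gen_fun c (of_real \<rho> * cis \<theta>) * gen_fun L (of_real \<rho> * cis \<theta>) ^ N) \<longlongrightarrow> ?G \<theta>)
        (at_left 1)"
      unfolding L_bdry_def by (intro tendsto_intros gen_fun_radial_limit)
  qed
  moreover have "absorb_prob M \<alpha> \<beta> \<gamma> = (\<Sum>t. (cmod (case_nat 0 ?a t))\<^sup>2)"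
    using suminf_split_head[OF sums_summable[OF calculation]]
    by (simp add: absorb_prob_eq[OF assms(2,1)])
  ultimately show ?thesis
    by (simp add: sums_iff M norm_mult norm_power power_mult_distrib power_mult[symmetric] mult.commute)
qed

theorem mainTheorem2:
  fixes M :: nat
  assumes "M \<ge> 1"
  shows "absorb_prob M 1 0 0 =
           1 / (2 * pi) * integral {0..2 * pi} (\<lambda>\<theta>. cmod (L_bdry \<theta>) ^ (2 * M)) \<and>
         absorb_prob M 0 1 0 =
           1 / (2 * pi) * integral {0..2 * pi} (\<lambda>\<theta>. (cmod (S_bdry \<theta>))\<^sup>2 * cmod (L_bdry \<theta>) ^ (2 * M - 2)) \<and>
         absorb_prob M 0 0 1 =
           1 / (2 * pi) * integral {0..2 * pi} (\<lambda>\<theta>. (cmod (R_bdry \<theta>))\<^sup>2 * cmod (L_bdry \<theta>) ^ (2 * M - 2))"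
proof -
  have "init_state 1 0 0 = ket 0 L" "init_state 0 1 0 = ket 0 S" "init_state 0 0 1 = ket 0 R"
    by (simp_all add: init_state_def fun_eq_iff)
  note this[THEN absorb_prob_integral[OF assms]]
  \<comment> \<open>Subtraction of naturals is truncated, so this uses
    \<open>M \<ge> 1\<close>.\<close>
  moreover have "2 + (2 * M - 2) = 2 * M"
    using assms by simp
  then have "(cmod (L_bdry \<theta>))\<^sup>2 * cmod (L_bdry \<theta>) ^ (2 * M - 2) = cmod (L_bdry \<theta>) ^ (2 * M)" for \<theta>
    by (simp only: power_add[symmetric])
  ultimately show ?thesis
    by (simp flip: L_bdry_def S_bdry_def R_bdry_def)
qed

end
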